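(* Let $X$ be a compact metric space with metric $d$ and $\mathcal{F}=(f_t)_{t\in\mathbb{R}}$ a continuous flow on $X$. Suppose $(X,\mathcal{F})$ has specification and let $A$ be a proper subset of $X$ which is compact and $\mathcal{F}$-invariant. Let $\epsilon>0$ be such that there exists $y\notin A$ with $d(A,y)>3\epsilon$. If there exists $C>0$ such that for every $t>0$ and every maximal $(t,3\epsilon)$-separated set $E_t\subset A$ we have $\#E_t\ge Ce^{t\,h(A)}$, then $h(A)<h(X)$.
   Context: A set $E$ is $(t,\epsilon)$-separated if for distinct $x,y\in E$ there is $s\in[0,t]$ with $d(f_sx,f_sy)\ge\epsilon$; maximal means maximal with respect to inclusion among $(t,3\epsilon)$-separated subsets of $A$. $h(A)=\lim_{\epsilon\to0}\limsup_{t\to\infty}\frac1t\log\sup\{\#E:E\subset A\ (t,\epsilon)\text{-separated}\}$ is the topological entropy of the flow on $A$, and $h(X)$ that of the flow on $X$. $(X,\mathcal{F})$ has specification if for every $\delta>0$ there is $\tau>0$ such that for every finite collection $\{(x_i,t_i)\}_{i=1}^n\subset X\times[0,\infty)$ there is $y\in X$ with $d(f_sx_i,f_{s+\sum_{j=1}^{i-1}(\tau+t_j)}y)\le\delta$ for all $s\in[0,t_i]$ and all $i$. *)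

theory Defs
  imports "HOL-Analysis.Analysis"
begin

text \<open>The space \<open>X\<close> is a subset of a metric type, and a flow on it is a map
  \<open>f :: real \<Rightarrow> 'a \<Rightarrow> 'a\<close> whose values outside \<open>X\<close> are irrelevant.\<close>

definition continuous_flow_on :: "'a::metric_space set \<Rightarrow> (real \<Rightarrow> 'a \<Rightarrow> 'a) \<Rightarrow> bool" where
  "continuous_flow_on X f \<longleftrightarrow>
     (\<forall>t. \<forall>x\<in>X. f t x \<in> X) \<and>
     (\<forall>x\<in>X. f 0 x = x) \<and>
     (\<forall>s t. \<forall>x\<in>X. f (s + t) x = f s (f t x)) \<and>
     continuous_on (UNIV \<times> X) (\<lambda>(t, x). f t x)"

definition flow_invariant :: "(real \<Rightarrow> 'a \<Rightarrow> 'a) \<Rightarrow> 'a set \<Rightarrow> bool" where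
  "flow_invariant f A \<longleftrightarrow> (\<forall>t. f t ` A = A)"

definition flow_separated :: "(real \<Rightarrow> 'a::metric_space \<Rightarrow> 'a) \<Rightarrow> real \<Rightarrow> real \<Rightarrow> 'a set \<Rightarrow> bool" where
  "flow_separated f t \<epsilon> E \<longleftrightarrow>
     (\<forall>x\<in>E. \<forall>y\<in>E. x \<noteq> y \<longrightarrow> (\<exists>s\<in>{0..t}. dist (f s x) (f s y) \<ge> \<epsilon>))"

definition maximal_flow_separated ::
  "(real \<Rightarrow> 'a::metric_space \<Rightarrow> 'a) \<Rightarrow> 'a set \<Rightarrow> real \<Rightarrow> real \<Rightarrow> 'a set \<Rightarrow> bool" where
  "maximal_flow_separated f A t \<epsilon> E \<longleftrightarrow>
     E \<subseteq> A \<and> flow_separated f t \<epsilon> E \<and>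
     (\<forall>E'. E \<subseteq> E' \<and> E' \<subseteq> A \<and> flow_separated f t \<epsilon> E' \<longrightarrow> E' = E)"

definition ecard :: "'a set \<Rightarrow> ereal" where
  "ecard E = (if finite E then ereal (real (card E)) else \<infinity>)"

definition ereal_ln :: "ereal \<Rightarrow> ereal" where
  "ereal_ln x = (case x of ereal r \<Rightarrow> (if r \<le> 0 then -\<infinity> else ereal (ln r)) | PInfty \<Rightarrow> \<infinity> | MInfty \<Rightarrow> -\<infinity>)"

definition ereal_exp :: "ereal \<Rightarrow> ereal" where
  "ereal_exp x = (case x of ereal r \<Rightarrow> ereal (exp r) | PInfty \<Rightarrow> \<infinity> | MInfty \<Rightarrow> 0)"

text \<open>Entropy may be \<open>\<infinity>\<close>, and it is \<open>-\<infinity>\<close> for the empty set. The limit as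
  \<open>\<epsilon>\<close> tends to \<open>0\<close> always exists in \<^typ>\<open>ereal\<close>, because the \<open>limsup\<close> is antitone in \<open>\<epsilon>\<close>.\<close>

definition flow_entropy :: "(real \<Rightarrow> 'a::metric_space \<Rightarrow> 'a) \<Rightarrow> 'a set \<Rightarrow> ereal" where
  "flow_entropy f A =
     Lim (at_right (0::real)) (\<lambda>\<epsilon>.
       Limsup at_top (\<lambda>t::real.
         ereal (1 / t) * ereal_ln (SUP E \<in> {E. E \<subseteq> A \<and> flow_separated f t \<epsilon> E}. ecard E)))"

definition flow_specification :: "'a::metric_space set \<Rightarrow> (real \<Rightarrow> 'a \<Rightarrow> 'a) \<Rightarrow> bool" where
  "flow_specification X f \<longleftrightarrow>
     (\<forall>\<delta>>0. \<exists>\<tau>>0. \<forall>(n::nat) (x :: nat \<Rightarrow> 'a) (t :: nat \<Rightarrow> real).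
        (\<forall>i\<in>{1..n}. x i \<in> X \<and> t i \<ge> 0) \<longrightarrow>
        (\<exists>y\<in>X. \<forall>i\<in>{1..n}. \<forall>s\<in>{0..t i}.
           dist (f s (x i)) (f (s + (\<Sum>j\<in>{1..<i}. \<tau> + t j)) y) \<le> \<delta>))"

text \<open>Unlike \<^const>\<open>infdist\<close>, which is \<open>0\<close> on the empty set, this distance uses the
  convention \<open>inf \<emptyset> = \<infinity>\<close>, so that the case \<open>A = {}\<close> is not excluded.\<close>

definition dist_to_set :: "'a::metric_space set \<Rightarrow> 'a \<Rightarrow> ereal" where
  "dist_to_set A y = (INF a\<in>A. ereal (dist a y))"

end

theory Submission
  imports Defs
begin

text \<open>By specification an orbit can be made to visit \<open>y\<close> at any prescribed set of multiples of
  a period \<open>L\<close> and to shadow arbitrary orbit segments of \<open>A\<close> in between. Since \<open>y\<close> is far from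
  \<open>A\<close>, orbits with different visiting times are separated. Each visit costs only a constant
  factor \<open>K\<close> in the number of available segments, because the lower bound for maximal separated
  sets is purely exponential, so summing \<open>K ^ card J\<close> over all sets \<open>J\<close> of visiting times gives
  about \<open>(1 + K) ^ N * exp (h(A) * N * L)\<close> separated orbits of length \<open>N * L\<close>, and the
  entropy increases by at least \<open>ln (1 + K) / L\<close>.\<close>

section \<open>Lower bounds for the entropy\<close>

lemma ereal_ln_mono: "x \<le> y \<Longrightarrow> ereal_ln x \<le> ereal_ln y"
  by (cases x; cases y) (auto simp: ereal_ln_def)

lemma tendsto_at_right_SUP_antimono:
  fixes g :: "real \<Rightarrow> ereal"
  assumes anti: "\<And>d e. 0 < d \<Longrightarrow> d \<le> e \<Longrightarrow> g e \<le> g d"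
  shows "(g \<longlongrightarrow> (SUP e\<in>{0<..}. g e)) (at_right 0)"
proof (rule order_tendstoI)
  fix a assume "a < (SUP e\<in>{0<..}. g e)"
  then obtain e where "e > 0" "a < g e" by (auto simp: less_SUP_iff)
  then show "\<forall>\<^sub>F x in at_right 0. a < g x"
    unfolding eventually_at_right_field using anti by (meson less_imp_le less_le_trans)
next
  fix a assume a: "(SUP e\<in>{0<..}. g e) < a"
  have "g x < a" if "x > 0" for x
    using SUP_upper[of x "{0<..}" g] a that by (auto intro: le_less_trans)
  then show "\<forall>\<^sub>F x in at_right 0. g x < a"
    unfolding eventually_at_right_field by (auto intro: exI[of _ 1])
qed

text \<open>A finer scale admits more separated sets, so the growth rate is antitone in
  \<open>\<epsilon>\<close> and its limit at 0 is a supremum; hence each fixed scale already bounds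
  the entropy from below.\<close>

lemma flow_entropy_eq_SUP:
  "flow_entropy f A = (SUP \<epsilon>\<in>{0<..}. Limsup at_top (\<lambda>t::real.
     ereal (1 / t) * ereal_ln (SUP E \<in> {E. E \<subseteq> A \<and> flow_separated f t \<epsilon> E}. ecard E)))"
  unfolding flow_entropy_def
proof (rule tendsto_Lim[OF _ tendsto_at_right_SUP_antimono])
  fix d e :: real assume "0 < d" "d \<le> e"
  have "(SUP E \<in> {E. E \<subseteq> A \<and> flow_separated f t e E}. ecard E)
      \<le> (SUP E \<in> {E. E \<subseteq> A \<and> flow_separated f t d E}. ecard E)" for t
    using \<open>d \<le> e\<close> unfolding flow_separated_def
    by (intro SUP_subset_mono subsetI CollectI order_refl) (blast intro: order_trans)
  \<comment> \<open>Only large \<open>t\<close> count in the limsup, and for \<open>t > 0\<close>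
    multiplication by \<open>1 / t\<close> preserves the order.\<close>
  then show "Limsup at_top (\<lambda>t::real.
       ereal (1 / t) * ereal_ln (SUP E \<in> {E. E \<subseteq> A \<and> flow_separated f t e E}. ecard E))
     \<le> Limsup at_top (\<lambda>t::real.
       ereal (1 / t) * ereal_ln (SUP E \<in> {E. E \<subseteq> A \<and> flow_separated f t d E}. ecard E))"
    by (intro Limsup_mono eventually_mono[OF eventually_gt_at_top[of 0]]
        ereal_mult_left_mono ereal_ln_mono) auto
qed simp

text \<open>A limsup is at least any bound that is reached at arbitrarily large times, so a single
  scale and one large set beyond each \<open>T\<close> suffice.\<close>

lemma flow_entropy_geI:
  assumes "\<epsilon> > 0"
    and ex: "\<And>T. \<exists>t>T. \<exists>E\<subseteq>X. finite E \<and> E \<noteq> {} \<and> flow_separated f t \<epsilon> E \<and> c * t \<le> ln (card E)"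
  shows "ereal c \<le> flow_entropy f X"
proof -
  let ?g = "\<lambda>t::real. ereal (1 / t) * ereal_ln (SUP E \<in> {E. E \<subseteq> X \<and> flow_separated f t \<epsilon> E}. ecard E)"
  have "ereal c \<le> Limsup at_top ?g"
    unfolding Limsup_def
  proof (rule INF_greatest)
    fix P :: "real \<Rightarrow> bool" assume "P \<in> {P. eventually P at_top}"
    then obtain T where T: "\<And>t. t \<ge> T \<Longrightarrow> P t" by (auto simp: eventually_at_top_linorder)
    obtain t E where t: "t > max 0 T" and E: "E \<subseteq> X" "finite E" "E \<noteq> {}"
      "flow_separated f t \<epsilon> E" "c * t \<le> ln (card E)"
      using ex by blast
    have "ereal c \<le> ereal (1 / t) * ereal (ln (card E))"
      using E(5) t by (simp add: field_simps)
    also have "ereal (ln (card E)) = ereal_ln (ecard E)"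
      using E by (simp add: ecard_def ereal_ln_def card_gt_0_iff)
    also have "ereal (1 / t) * ereal_ln (ecard E) \<le> ?g t"
      using t E by (intro ereal_mult_left_mono ereal_ln_mono SUP_upper) auto
    also have "\<dots> \<le> (SUP t\<in>{t. P t}. ?g t)"
      using t T by (intro SUP_upper) auto
    finally show "ereal c \<le> (SUP t\<in>{t. P t}. ?g t)" .
  qed
  also have "\<dots> \<le> flow_entropy f X"
    unfolding flow_entropy_eq_SUP using \<open>\<epsilon> > 0\<close> by (intro SUP_upper2[of \<epsilon>]) auto
  finally show ?thesis .
qed

section \<open>Maximal separated sets\<close>

lemma flow_equicontinuous:
  fixes f :: "real \<Rightarrow> 'a::metric_space \<Rightarrow> 'b::metric_space"
  assumes "continuous_on (UNIV \<times> A) (\<lambda>(t, x). f t x)" "compact A" "\<epsilon> > 0"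
  obtains \<delta> where "\<delta> > 0" and
    "\<And>x y s. x \<in> A \<Longrightarrow> y \<in> A \<Longrightarrow> s \<in> {0..t} \<Longrightarrow> dist x y < \<delta> \<Longrightarrow> dist (f s x) (f s y) < \<epsilon>"
proof -
  have "uniformly_continuous_on ({0..t} \<times> A) (\<lambda>(t, x). f t x)"
    by (rule compact_uniformly_continuous[OF continuous_on_subset[OF assms(1)] compact_Times])
      (use assms(2) in auto)
  from uniformly_continuous_onE[OF this \<open>\<epsilon> > 0\<close>]
  obtain \<delta> where d: "\<delta> > 0" "\<And>p q. p \<in> {0..t} \<times> A \<Longrightarrow> q \<in> {0..t} \<times> A \<Longrightarrow> dist q p < \<delta> \<Longrightarrow>
      dist (case q of (t, x) \<Rightarrow> f t x) (case p of (t, x) \<Rightarrow> f t x) < \<epsilon>"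
    by blast
  show ?thesis
  proof (rule that[OF d(1)])
    fix x y s assume "x \<in> A" "y \<in> A" "s \<in> {0..t}" "dist x y < \<delta>"
    then show "dist (f s x) (f s y) < \<epsilon>"
      using d(2)[of "(s, y)" "(s, x)"] by (simp add: dist_Pair_Pair)
  qed
qed

text \<open>Points in a common ball of radius \<open>\<delta> / 2\<close> stay closer than
  \<open>\<epsilon>\<close> up to time \<open>t\<close>, so a separated set injects into a finite
  set of ball centres.\<close>

lemma card_flow_separated_bounded:
  assumes "continuous_on (UNIV \<times> A) (\<lambda>(t, x). f t x)" "compact A" "\<epsilon> > 0"
  obtains k where "\<And>E. E \<subseteq> A \<Longrightarrow> flow_separated f t \<epsilon> E \<Longrightarrow> finite E \<and> card E \<le> k"
proof -
  obtain \<delta> where d: "\<delta> > 0"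
    "\<And>x y s. x \<in> A \<Longrightarrow> y \<in> A \<Longrightarrow> s \<in> {0..t} \<Longrightarrow> dist x y < \<delta> \<Longrightarrow> dist (f s x) (f s y) < \<epsilon>"
    using flow_equicontinuous[OF assms] by blast
  obtain K where K: "finite K" "A \<subseteq> (\<Union>x\<in>K. ball x (\<delta> / 2))"
    using \<open>compact A\<close> half_gt_zero[OF d(1)] unfolding compact_eq_totally_bounded by blast
  show ?thesis
  proof (rule that)
    fix E assume E: "E \<subseteq> A" "flow_separated f t \<epsilon> E"
    have "\<forall>x\<in>E. \<exists>c\<in>K. dist c x < \<delta> / 2" using E(1) K(2) by (auto simp: subset_iff)
    then obtain c where c: "\<And>x. x \<in> E \<Longrightarrow> c x \<in> K \<and> dist (c x) x < \<delta> / 2" by metis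
    have "inj_on c E"
    proof (rule inj_onI, rule ccontr)
      fix x y assume xy: "x \<in> E" "y \<in> E" "c x = c y" "x \<noteq> y"
      then obtain s where s: "s \<in> {0..t}" "dist (f s x) (f s y) \<ge> \<epsilon>"
        using E(2) unfolding flow_separated_def by blast
      have "dist x y < \<delta>" using c[of x] c[of y] xy dist_triangle_half_r[of "c x" x \<delta> y] by simp
      then show False using d(2)[of x y s] s xy E(1) by auto
    qed
    moreover have "c ` E \<subseteq> K" using c by auto
    ultimately show "finite E \<and> card E \<le> card K"
      using K(1) by (auto intro: inj_on_finite card_inj_on_le)
  qed
qed

text \<open>A separated set of greatest cardinality is maximal for inclusion; the uniform bound on
  cardinalities provides one.\<close>

lemma maximal_flow_separated_exists:
  assumes "continuous_on (UNIV \<times> A) (\<lambda>(t, x). f t x)" "compact A" "\<epsilon> > 0"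
  obtains E where "maximal_flow_separated f A t \<epsilon> E" "finite E"
proof -
  obtain k where k: "\<And>E. E \<subseteq> A \<Longrightarrow> flow_separated f t \<epsilon> E \<Longrightarrow> finite E \<and> card E \<le> k"
    by (rule card_flow_separated_bounded[OF assms, where t = t]) (rule that)
  let ?P = "\<lambda>E. E \<subseteq> A \<and> flow_separated f t \<epsilon> E"
  have "\<exists>E. ?P E \<and> (\<forall>E'. ?P E' \<longrightarrow> card E' \<le> card E)"
  proof (rule ex_has_greatest_nat[of ?P "{}" card "Suc k"])
    show "?P {}" by (simp add: flow_separated_def)
    show "\<forall>E. ?P E \<longrightarrow> card E < Suc k" using k by (simp add: less_Suc_eq_le)
  qed
  then obtain E where E: "?P E" "\<forall>E'. ?P E' \<longrightarrow> card E' \<le> card E" by blast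
  show ?thesis
  proof (rule that)
    show "maximal_flow_separated f A t \<epsilon> E"
      unfolding maximal_flow_separated_def
    proof (intro conjI allI impI)
      fix E' assume E': "E \<subseteq> E' \<and> ?P E'"
      then have "finite E'" "card E' \<le> card E" using E(2) k[of E'] by simp_all
      with E' show "E' = E" using card_seteq[of E' E] by simp
    qed (use E(1) in simp_all)
    show "finite E" using E(1) k[of E] by simp
  qed
qed

section \<open>Orbits following prescribed words\<close>

text \<open>A letter \<open>(m, x)\<close> stands for a visit to \<open>y\<close> followed by a segment of the orbit of
  \<open>x\<close>, with gaps of length \<open>\<tau>\<close> on both sides; it occupies time \<open>m * L\<close> altogether.\<close>

fun follows :: "(real \<Rightarrow> 'a::metric_space \<Rightarrow> 'a) \<Rightarrow> real \<Rightarrow> real \<Rightarrow> real \<Rightarrow> 'a \<Rightarrow> 'a \<Rightarrow> (nat \<times> 'a) list \<Rightarrow> bool"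
  where
    "follows f \<delta> \<tau> L y z [] \<longleftrightarrow> dist y z \<le> \<delta>"
  | "follows f \<delta> \<tau> L y z ((m, x) # w) \<longleftrightarrow> dist y z \<le> \<delta> \<and>
       (\<forall>s\<in>{0..m * L - 2 * \<tau>}. dist (f s x) (f (s + \<tau>) z) \<le> \<delta>) \<and>
       follows f \<delta> \<tau> L y (f (m * L) z) w"

lemma follows_start: "follows f \<delta> \<tau> L y z w \<Longrightarrow> dist y z \<le> \<delta>"
  by (cases w) auto

text \<open>The conclusion of specification made recursive: moving \<open>z\<close> along the flow
  after each segment replaces the partial sums of elapsed times and allows induction on the
  list.\<close>

fun shadows :: "(real \<Rightarrow> 'a::metric_space \<Rightarrow> 'a) \<Rightarrow> real \<Rightarrow> real \<Rightarrow> 'a \<Rightarrow> ('a \<times> real) list \<Rightarrow> bool"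
  where
    "shadows f \<delta> \<tau> z [] \<longleftrightarrow> True"
  | "shadows f \<delta> \<tau> z ((x, t) # w) \<longleftrightarrow> (\<forall>s\<in>{0..t}. dist (f s x) (f s z) \<le> \<delta>) \<and>
       shadows f \<delta> \<tau> (f (\<tau> + t) z) w"

lemma shadowsI:
  assumes flow: "continuous_flow_on X f" and "z \<in> X"
    and "\<And>i s. i < length w \<Longrightarrow> s \<in> {0..snd (w ! i)} \<Longrightarrow>
      dist (f s (fst (w ! i))) (f (s + (\<Sum>j<i. \<tau> + snd (w ! j))) z) \<le> \<delta>"
  shows "shadows f \<delta> \<tau> z w"
  using assms(2,3)
proof (induction w arbitrary: z)
  case (Cons a w)
  obtain x t where a: "a = (x, t)" by (cases a)
  have "dist (f s x) (f s z) \<le> \<delta>" if "s \<in> {0..t}" for s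
    using Cons.prems(2)[of 0 s] that a by simp
  moreover have "shadows f \<delta> \<tau> (f (\<tau> + t) z) w"
  proof (rule Cons.IH)
    show "f (\<tau> + t) z \<in> X" using flow Cons.prems(1) by (simp add: continuous_flow_on_def)
    fix i s assume "i < length w" "s \<in> {0..snd (w ! i)}"
    then have "dist (f s (fst (w ! i))) (f ((s + (\<Sum>j<i. \<tau> + snd (w ! j))) + (\<tau> + t)) z) \<le> \<delta>"
      using Cons.prems(2)[of "Suc i" s] a by (simp add: sum.lessThan_Suc_shift algebra_simps del: sum.lessThan_Suc)
    then show "dist (f s (fst (w ! i))) (f (s + (\<Sum>j<i. \<tau> + snd (w ! j))) (f (\<tau> + t) z)) \<le> \<delta>"
      using flow Cons.prems(1) by (simp add: continuous_flow_on_def)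
  qed
  ultimately show ?case by (simp add: a)
qed simp

lemma flow_specification_shadows:
  fixes f :: "real \<Rightarrow> 'a::metric_space \<Rightarrow> 'a"
  assumes "continuous_flow_on X f" "flow_specification X f" "\<delta> > 0"
  obtains \<tau> where "\<tau> > 0" and
    "\<And>w. set w \<subseteq> X \<times> {0..} \<Longrightarrow> \<exists>z\<in>X. shadows f \<delta> \<tau> z w"
proof -
  obtain \<tau> where t: "\<tau> > 0" "\<And>(n::nat) x t. (\<forall>i\<in>{1..n}. x i \<in> X \<and> (t i :: real) \<ge> 0) \<Longrightarrow>
        (\<exists>y\<in>X. \<forall>i\<in>{1..n}. \<forall>s\<in>{0..t i}.
           dist (f s (x i)) (f (s + (\<Sum>j\<in>{1..<i}. \<tau> + t j)) y) \<le> \<delta>)"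
    using assms(2,3) unfolding flow_specification_def by metis
  show ?thesis
  proof (rule that[OF t(1)])
    fix w :: "('a \<times> real) list" assume w: "set w \<subseteq> X \<times> {0..}"
    have nth: "fst (w ! i) \<in> X \<and> snd (w ! i) \<ge> 0" if "i < length w" for i
      using w nth_mem[OF that] by (auto simp: mem_Times_iff)
    \<comment> \<open>Specification numbers the segments from 1, lists from 0; hence the index
      \<open>i - 1\<close>.\<close>
    then have "\<forall>i\<in>{1..length w}. fst (w ! (i - 1)) \<in> X \<and> snd (w ! (i - 1)) \<ge> 0"
      by auto
    then have "\<exists>z\<in>X. \<forall>i\<in>{1..length w}. \<forall>s\<in>{0..snd (w ! (i - 1))}.
        dist (f s (fst (w ! (i - 1)))) (f (s + (\<Sum>j\<in>{1..<i}. \<tau> + snd (w ! (j - 1)))) z) \<le> \<delta>"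
      by (rule t(2))
    then obtain z where z: "z \<in> X" "\<And>i s. i \<in> {1..length w} \<Longrightarrow> s \<in> {0..snd (w ! (i - 1))} \<Longrightarrow>
        dist (f s (fst (w ! (i - 1)))) (f (s + (\<Sum>j\<in>{1..<i}. \<tau> + snd (w ! (j - 1)))) z) \<le> \<delta>"
      by blast
    have "(\<Sum>j\<in>{1..<Suc i}. \<tau> + snd (w ! (j - 1))) = (\<Sum>j<i. \<tau> + snd (w ! j))" for i
      by (rule sum.reindex_bij_witness[of _ Suc "\<lambda>j. j - 1"]) auto
    then have "shadows f \<delta> \<tau> z w"
      using z(2)[of "Suc _"] by (intro shadowsI[OF assms(1) z(1)]) (auto simp del: sum.op_ivl_Suc)
    then show "\<exists>z\<in>X. shadows f \<delta> \<tau> z w" using z(1) by blast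
  qed
qed

text \<open>A visit to \<open>y\<close> is a segment of duration 0. The empty word still yields one
  visit, so that the orbit is near \<open>y\<close> after every letter, including the last.\<close>

fun segments :: "real \<Rightarrow> real \<Rightarrow> 'a \<Rightarrow> (nat \<times> 'a) list \<Rightarrow> ('a \<times> real) list" where
  "segments \<tau> L y [] = [(y, 0)]"
| "segments \<tau> L y ((m, x) # w) = (y, 0) # (x, m * L - 2 * \<tau>) # segments \<tau> L y w"

text \<open>Gap, segment and second gap last
  \<open>\<tau> + (m * L - 2 * \<tau>) + \<tau> = m * L\<close>, exactly the time by which
  \<open>follows\<close> advances.\<close>

lemma follows_if_shadows:
  assumes flow: "continuous_flow_on X f"
  shows "z \<in> X \<Longrightarrow> y \<in> X \<Longrightarrow> shadows f \<delta> \<tau> z (segments \<tau> L y w) \<Longrightarrow> follows f \<delta> \<tau> L y z w"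
proof (induction \<tau> L y w arbitrary: z rule: segments.induct)
  case (2 \<tau> L y m x w)
  have comp: "f s (f t z) = f (s + t) z" for s t
    using flow 2 by (simp add: continuous_flow_on_def)
  have "f (m * L) z \<in> X" using flow 2 by (simp add: continuous_flow_on_def)
  then show ?case
    using 2 flow by (auto simp: comp algebra_simps) (auto simp: continuous_flow_on_def)
qed (use flow in \<open>auto simp: continuous_flow_on_def\<close>)

section \<open>Counting the words of a given total length\<close>

text \<open>The lengths in a word form a composition of \<open>N\<close>, which encodes the set of
  visiting times strictly between start and end. Splitting off the first letter, of positive length
  \<open>Suc m\<close>, yields a renewal recursion for the counts.\<close>

fun words :: "(nat \<Rightarrow> 'a set) \<Rightarrow> nat \<Rightarrow> (nat \<times> 'a) list set" where
  "words E 0 = {[]}"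
| "words E (Suc N) = (\<Union>m\<in>{..N}. (\<lambda>((m, x), w). (m, x) # w) ` (({Suc m} \<times> E (Suc m)) \<times> words E (N - m)))"

declare words.simps(2) [simp del]

lemma words_Nil [simp]: "[] \<in> words E N \<longleftrightarrow> N = 0"
  by (cases N) (auto simp: words.simps(2))

lemma words_Cons [simp]:
  "(m, x) # w \<in> words E N \<longleftrightarrow> 1 \<le> m \<and> m \<le> N \<and> x \<in> E m \<and> w \<in> words E (N - m)"
proof (cases N)
  case (Suc n)
  show ?thesis unfolding Suc
    by (cases m) (auto simp: words.simps(2) image_iff)
qed auto

text \<open>The pieces of the union are disjoint even when the sets \<open>E m\<close> overlap,
  because the first letter records its length; so the cardinalities add.\<close>

lemma words_finite_card:
  assumes "\<And>m. finite (E m)"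
  shows "finite (words E N)"
    and "card (words E (Suc N)) = (\<Sum>m\<le>N. card (E (Suc m)) * card (words E (N - m)))"
proof -
  show fin: "finite (words E N)" for N
  proof (induction N rule: less_induct)
    case (less N)
    then show ?case
      by (cases N) (auto simp: words.simps(2) assms intro!: finite_imageI finite_cartesian_product)
  qed
  have "card (words E (Suc N)) =
      (\<Sum>m\<le>N. card ((\<lambda>((m, x), w). (m, x) # w) ` (({Suc m} \<times> E (Suc m)) \<times> words E (N - m))))"
    unfolding words.simps(2) using assms fin by (intro card_UN_disjoint) auto
  also have "\<dots> = (\<Sum>m\<le>N. card (({Suc m} \<times> E (Suc m)) \<times> words E (N - m)))"
    by (intro sum.cong card_image refl) (auto simp: inj_on_def)
  finally show "card (words E (Suc N)) = (\<Sum>m\<le>N. card (E (Suc m)) * card (words E (N - m)))"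
    by (simp add: card_cartesian_product)
qed

text \<open>The recursion makes each partial sum at least \<open>1 + K\<close> times the previous
  one.\<close>

lemma sum_ge_power_of_renewal:
  fixes K :: real
  assumes "K \<ge> 0" "s 0 = 1" and rec: "\<And>n. s (Suc n) \<ge> K * (\<Sum>m\<le>n. s m)"
  shows "(\<Sum>m\<le>n. s m) \<ge> (1 + K) ^ n"
proof (induction n)
  case (Suc n)
  have "(1 + K) ^ Suc n \<le> (1 + K) * (\<Sum>m\<le>n. s m)"
    using Suc \<open>K \<ge> 0\<close> by (simp add: mult_left_mono)
  also have "\<dots> \<le> (\<Sum>m\<le>Suc n. s m)" using rec[of n] by (simp add: algebra_simps)
  finally show ?case .
qed (simp add: assms)

text \<open>Scaling the count by \<open>exp (- (n * a))\<close> removes the exponential growth;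
  since the bound on \<open>card (E m)\<close> is purely exponential, what remains is a renewal
  inequality with the constant \<open>K\<close>.\<close>

lemma card_words_ge:
  fixes K a :: real
  assumes "\<And>m. finite (E m)" "K \<ge> 0"
    and E: "\<And>m. m \<ge> 1 \<Longrightarrow> card (E m) \<ge> K * exp (m * a)"
  shows "card (words E (Suc N)) \<ge> K * (1 + K) ^ N * exp (Suc N * a)"
proof -
  define s where "s n = card (words E n) * exp (- (n * a))" for n
  have rec: "s (Suc n) \<ge> K * (\<Sum>m\<le>n. s m)" for n
  proof -
    \<comment> \<open>Reversed, the sum pairs a first letter of length \<open>Suc m\<close> with a
      rest of length \<open>n - m\<close>.\<close>
    have "K * (\<Sum>m\<le>n. s m) = K * (\<Sum>m\<le>n. s (n - m))"
      using sum.atLeastAtMost_rev[of s 0 n] by (simp add: atMost_atLeast0)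
    also have "\<dots> = (\<Sum>m\<le>n. K * exp (Suc m * a) * card (words E (n - m)) * exp (- (Suc n * a)))"
      unfolding sum_distrib_left
    proof (rule sum.cong[OF refl])
      fix m assume "m \<in> {..n}"
      then have "exp (- (real (n - m) * a)) = exp (Suc m * a) * exp (- (Suc n * a))"
        by (simp add: algebra_simps of_nat_diff flip: exp_add)
      then show "K * s (n - m) = K * exp (Suc m * a) * card (words E (n - m)) * exp (- (Suc n * a))"
        by (simp add: s_def)
    qed
    also have "\<dots> \<le> (\<Sum>m\<le>n. real (card (E (Suc m))) * real (card (words E (n - m))) * exp (- (Suc n * a)))"
      by (intro sum_mono mult_right_mono E) simp_all
    also have "\<dots> = s (Suc n)"
      by (simp add: s_def words_finite_card(2)[OF assms(1)] sum_distrib_right)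
    finally show ?thesis .
  qed
  have "K * (1 + K) ^ N \<le> K * (\<Sum>m\<le>N. s m)"
    using \<open>K \<ge> 0\<close> rec by (intro mult_left_mono sum_ge_power_of_renewal) (auto simp: s_def)
  also have "\<dots> \<le> s (Suc N)" by (rule rec)
  finally have "K * (1 + K) ^ N * exp (Suc N * a) \<le> s (Suc N) * exp (Suc N * a)"
    by (rule mult_right_mono) simp
  also have "\<dots> = card (words E (Suc N))"
    by (simp add: s_def mult.assoc flip: exp_add)
  finally show ?thesis .
qed

section \<open>Separation of orbits that follow different words\<close>

text \<open>At time \<open>m * L\<close> the first orbit visits \<open>y\<close>, while the second
  still shadows an orbit in the invariant set \<open>A\<close>. Of a distance above
  \<open>3 * \<epsilon>\<close>, two errors of at most \<open>\<epsilon>\<close> leave at least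
  \<open>\<epsilon>\<close>.\<close>

lemma follows_separated_less:
  fixes m m' :: nat and L \<tau> \<epsilon> :: real
  assumes inv: "flow_invariant f A"
    and far: "\<And>a. a \<in> A \<Longrightarrow> dist a y > 3 * \<epsilon>"
    and "0 < \<tau>" "\<tau> \<le> L" "x' \<in> A" "m < m'" "1 \<le> m"
    and z: "dist y (f (m * L) z) \<le> \<epsilon>"
    and z': "\<forall>s\<in>{0..m' * L - 2 * \<tau>}. dist (f s x') (f (s + \<tau>) z') \<le> \<epsilon>"
  shows "dist (f (m * L) z) (f (m * L) z') \<ge> \<epsilon>"
proof -
  \<comment> \<open>The segment of \<open>x'\<close> starts at time \<open>\<tau>\<close>, so time
    \<open>m * L\<close> is its time \<open>m * L - \<tau>\<close>; this lies inside because
    \<open>1 \<le> m\<close>, \<open>m + 1 \<le> m'\<close> and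
    \<open>\<tau> \<le> L\<close>.\<close>
  have "1 * L \<le> m * L" "(real m + 1) * L \<le> m' * L"
    using assms(3,4,6,7) by (intro mult_right_mono; simp)+
  then have "m * L - \<tau> \<in> {0..m' * L - 2 * \<tau>}"
    unfolding atLeastAtMost_iff using assms(3,4) by (simp only: distrib_right) linarith
  from bspec[OF z' this] have "dist (f (m * L - \<tau>) x') (f (m * L) z') \<le> \<epsilon>" by simp
  moreover have "f (m * L - \<tau>) x' \<in> A" using inv \<open>x' \<in> A\<close> by (auto simp: flow_invariant_def)
  ultimately show ?thesis
    using far[of "f (m * L - \<tau>) x'"] z
      dist_triangle[of "f (m * L - \<tau>) x'" y "f (m * L) z'"]
      dist_triangle[of "f (m * L) z'" y "f (m * L) z"]
    by (simp add: dist_commute)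
qed

text \<open>The orbits are compared at the first letter where the words differ. Different lengths
  are handled by \<open>follows_separated_less\<close>, different points by the separation of
  \<open>E m\<close>; equal letters are removed by flowing for time \<open>m * L\<close>.\<close>

lemma follows_separated:
  assumes flow: "continuous_flow_on X f" and inv: "flow_invariant f A"
    and far: "\<And>a. a \<in> A \<Longrightarrow> dist a y > 3 * \<epsilon>"
    and "0 < \<tau>" "\<tau> \<le> L"
    and E: "\<And>m. E m \<subseteq> A" "\<And>m. flow_separated f (m * L - 2 * \<tau>) (3 * \<epsilon>) (E m)"
    and "z \<in> X" "z' \<in> X" "w \<in> words E N" "w' \<in> words E N" "w \<noteq> w'"
    and "follows f \<epsilon> \<tau> L y z w" "follows f \<epsilon> \<tau> L y z' w'"
  shows "\<exists>s\<in>{0..N * L}. dist (f s z) (f s z') \<ge> \<epsilon>"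
  using assms(8-)
proof (induction w arbitrary: N z z' w')
  \<comment> \<open>Here \<open>N = 0\<close>, and the empty word is the only word of that
    length.\<close>
  case Nil
  then show ?case by (cases w') auto
next
  case (Cons p u)
  have "L > 0" using assms(4,5) by simp
  obtain m x where p: "p = (m, x)" by (cases p)
  with Cons.prems obtain m' x' u' where w': "w' = (m', x') # u'" by (cases w') auto
  note w = Cons.prems(3)[unfolded p words_Cons] Cons.prems(4)[unfolded w' words_Cons]
  note fol = Cons.prems(6)[unfolded p follows.simps] Cons.prems(7)[unfolded w' follows.simps]
  have le: "k * L \<in> {0..N * L}" if "k \<le> N" for k :: nat
    using that \<open>L > 0\<close> by (auto intro: mult_right_mono)
  have x: "x \<in> A" "x' \<in> A" using w E(1) by blast+
  have visit: "dist y (f (m * L) z) \<le> \<epsilon>" "dist y (f (m' * L) z') \<le> \<epsilon>"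
    using fol follows_start by blast+
  consider "m < m'" | "m' < m" | "m = m'" "x \<noteq> x'" | "m = m'" "x = x'" by linarith
  then show ?case
  proof cases
    case 1
    then have "dist (f (m * L) z) (f (m * L) z') \<ge> \<epsilon>"
      using follows_separated_less[OF inv far assms(4,5) x(2) _ _ visit(1)] w fol by blast
    then show ?thesis using le w by blast
  next
    case 2
    then have "dist (f (m' * L) z') (f (m' * L) z) \<ge> \<epsilon>"
      using follows_separated_less[OF inv far assms(4,5) x(1) _ _ visit(2)] w fol by blast
    then show ?thesis using le w by (metis dist_commute)
  next
    case 3
    then obtain s where s: "s \<in> {0..m * L - 2 * \<tau>}" "dist (f s x) (f s x') \<ge> 3 * \<epsilon>"
      using E(2)[of m] w unfolding flow_separated_def by blast
    have "dist (f s x) (f (s + \<tau>) z) \<le> \<epsilon>" "dist (f s x') (f (s + \<tau>) z') \<le> \<epsilon>"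
      using s(1) fol 3 by blast+
    \<comment> \<open>Of the separation \<open>3 * \<epsilon>\<close>, the two shadowing errors use
      up at most \<open>2 * \<epsilon>\<close>.\<close>
    then have "dist (f (s + \<tau>) z) (f (s + \<tau>) z') \<ge> \<epsilon>"
      using s(2) dist_triangle[of "f s x" "f s x'" "f (s + \<tau>) z"]
        dist_triangle[of "f (s + \<tau>) z" "f s x'" "f (s + \<tau>) z'"]
      by (simp add: dist_commute)
    moreover have "s + \<tau> \<in> {0..N * L}"
      using s(1) le[of m] w \<open>0 < \<tau>\<close> by auto
    ultimately show ?thesis by blast
  next
    case 4
    have "f (m * L) z \<in> X" "f (m * L) z' \<in> X"
      using flow Cons.prems(1,2) unfolding continuous_flow_on_def by blast+
    then have "\<exists>s\<in>{0..real (N - m) * L}. dist (f s (f (m * L) z)) (f s (f (m * L) z')) \<ge> \<epsilon>"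
      by (rule Cons.IH[where w' = u']) (use w fol 4 Cons.prems(5) p w' in blast)+
    then obtain s where s: "s \<in> {0..real (N - m) * L}"
      "dist (f s (f (m * L) z)) (f s (f (m * L) z')) \<ge> \<epsilon>" by blast
    then have "dist (f (s + m * L) z) (f (s + m * L) z') \<ge> \<epsilon>"
      using flow Cons.prems(1,2) by (simp add: continuous_flow_on_def)
    moreover have "s + m * L \<in> {0..N * L}"
      using s(1) w le[of m] by (auto simp: of_nat_diff algebra_simps)
    ultimately show ?thesis by blast
  qed
qed

text \<open>Specification gives each word an orbit; separation with \<open>\<epsilon> > 0\<close>
  makes this choice injective, so the separated set has as many points as there are words.\<close>

lemma separated_set_of_words:
  assumes flow: "continuous_flow_on X f" and inv: "flow_invariant f A"
    and far: "\<And>a. a \<in> A \<Longrightarrow> dist a y > 3 * \<epsilon>" and "\<epsilon> > 0"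
    and "0 < \<tau>" "2 * \<tau> \<le> L" "A \<subseteq> X" "y \<in> X"
    and shad: "\<And>w. set w \<subseteq> X \<times> {0..} \<Longrightarrow> \<exists>z\<in>X. shadows f \<epsilon> \<tau> z w"
    and E: "\<And>m. E m \<subseteq> A" "\<And>m. flow_separated f (m * L - 2 * \<tau>) (3 * \<epsilon>) (E m)"
  obtains g where "g ` words E N \<subseteq> X" "flow_separated f (N * L) \<epsilon> (g ` words E N)"
    "inj_on g (words E N)"
proof -
  have seg: "set (segments \<tau> L y w) \<subseteq> X \<times> {0..}" if "w \<in> words E n" for w n
    using that
  proof (induction w arbitrary: n)
    case (Cons p w)
    obtain m x where p: "p = (m, x)" by (cases p)
    note w = Cons.prems[unfolded p words_Cons]
    \<comment> \<open>Specification demands nonnegative durations, and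
      \<open>m * L - 2 * \<tau>\<close> is nonnegative because \<open>m \<ge> 1\<close> and
      \<open>2 * \<tau> \<le> L\<close>.\<close>
    have "1 * L \<le> m * L" using w assms(5,6) by (intro mult_right_mono) auto
    then show ?case
      using Cons.IH[of "n - m"] w E(1) \<open>A \<subseteq> X\<close> \<open>y \<in> X\<close> assms(6) by (auto simp: p)
  qed (use \<open>y \<in> X\<close> in auto)
  have "\<exists>z\<in>X. follows f \<epsilon> \<tau> L y z w" if "w \<in> words E N" for w
    using shad[OF seg[OF that]] follows_if_shadows[OF flow _ \<open>y \<in> X\<close>] by blast
  then obtain g where g: "\<And>w. w \<in> words E N \<Longrightarrow> g w \<in> X \<and> follows f \<epsilon> \<tau> L y (g w) w"
    by metis
  have sep: "\<exists>s\<in>{0..N * L}. dist (f s (g w)) (f s (g w')) \<ge> \<epsilon>"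
    if "w \<in> words E N" "w' \<in> words E N" "w \<noteq> w'" for w w'
    by (rule follows_separated[OF flow inv far _ _ E])
      (use g that assms(5,6) in auto)
  show ?thesis
  proof (rule that)
    show "g ` words E N \<subseteq> X" using g by blast
    show "flow_separated f (N * L) \<epsilon> (g ` words E N)"
      unfolding flow_separated_def using sep by blast
    show "inj_on g (words E N)"
      using sep \<open>\<epsilon> > 0\<close> by (intro inj_onI) (metis dist_self not_le)
  qed
qed

section \<open>Choice of the constants and strict growth of the entropy\<close>

text \<open>For absorbing lower-order terms: a larger slope eventually outweighs both a constant and
  the shift from \<open>N\<close> to \<open>Suc N\<close>.\<close>

lemma eventually_affine_le:
  fixes a b c :: real
  assumes "a < b"
  shows "\<forall>\<^sub>F N in sequentially. a * real (Suc N) \<le> b * real N + c"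
proof -
  have "\<forall>\<^sub>F N in sequentially. (a - c) / (b - a) \<le> real N"
    using filterlim_real_sequentially by (simp add: filterlim_at_top)
  then show ?thesis
    by eventually_elim (use assms in \<open>simp add: field_simps\<close>)
qed

theorem theorem4p9:
  fixes X A :: "'a::metric_space set"
    and f :: "real \<Rightarrow> 'a \<Rightarrow> 'a"
    and \<epsilon> :: real
  assumes "compact X"
    and "continuous_flow_on X f"
    and "flow_specification X f"
    and "A \<subset> X"
    and "compact A"
    and "flow_invariant f A"
    and "\<epsilon> > 0"
    and "\<exists>y\<in>X. y \<notin> A \<and> dist_to_set A y > ereal (3 * \<epsilon>)"
    and "\<exists>C>0. \<forall>t>0. \<forall>E. maximal_flow_separated f A t (3 * \<epsilon>) E \<longrightarrow>
           ecard E \<ge> ereal C * ereal_exp (ereal t * flow_entropy f A)"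
  shows "flow_entropy f A < flow_entropy f X"
proof -
  obtain y where y: "y \<in> X" "dist_to_set A y > ereal (3 * \<epsilon>)" using assms(8) by blast
  have far: "dist a y > 3 * \<epsilon>" if "a \<in> A" for a
  proof -
    have "dist_to_set A y \<le> ereal (dist a y)"
      unfolding dist_to_set_def using that by (rule INF_lower)
    with y(2) have "ereal (3 * \<epsilon>) < ereal (dist a y)" by (rule less_le_trans)
    then show ?thesis by simp
  qed
  obtain C where C: "C > 0" "\<And>t E. t > 0 \<Longrightarrow> maximal_flow_separated f A t (3 * \<epsilon>) E \<Longrightarrow>
           ecard E \<ge> ereal C * ereal_exp (ereal t * flow_entropy f A)"
    using assms(9) by blast
  have cont: "continuous_on (UNIV \<times> A) (\<lambda>(t, x). f t x)"
    using assms(2,4) unfolding continuous_flow_on_def by (blast intro: continuous_on_subset)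
  \<comment> \<open>The growth hypothesis speaks only of maximal sets, so a finite one is fixed for
    every time.\<close>
  have "\<exists>E. maximal_flow_separated f A t (3 * \<epsilon>) E \<and> finite E" for t
    using maximal_flow_separated_exists[OF cont assms(5), of "3 * \<epsilon>" t] \<open>\<epsilon> > 0\<close> by auto
  then obtain M where M: "\<And>t. maximal_flow_separated f A t (3 * \<epsilon>) (M t)" "\<And>t. finite (M t)"
    by metis
  show ?thesis
  proof (cases "flow_entropy f A")
    \<comment> \<open>Infinite entropy would force the finite set \<open>M 1\<close> to have
      infinite cardinality.\<close>
    case PInf
    then show ?thesis
      using C(2)[OF zero_less_one M(1)] M(2)[of 1] C(1) by (simp add: ereal_exp_def ecard_def)
  next
    \<comment> \<open>This value occurs for \<open>A = {}\<close>; the single point \<open>y\<close>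
      already gives \<open>X\<close> entropy at least 0.\<close>
    case MInf
    have "ereal 0 \<le> flow_entropy f X"
    proof (rule flow_entropy_geI[OF \<open>\<epsilon> > 0\<close>])
      fix T :: real
      show "\<exists>t>T. \<exists>E\<subseteq>X. finite E \<and> E \<noteq> {} \<and> flow_separated f t \<epsilon> E \<and> 0 * t \<le> ln (card E)"
        using y(1) by (intro exI[of _ "T + 1"] conjI exI[of _ "{y}"]) (auto simp: flow_separated_def)
    qed
    then show ?thesis using MInf by auto
  next
    case (real h)
    obtain \<tau> where \<tau>: "\<tau> > 0" "\<And>w. set w \<subseteq> X \<times> {0..} \<Longrightarrow> \<exists>z\<in>X. shadows f \<epsilon> \<tau> z w"
      using flow_specification_shadows[OF assms(2,3,7)] by blast
    \<comment> \<open>With \<open>L > 2 * \<tau>\<close>, every letter with \<open>m \<ge> 1\<close>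
      has a segment of positive duration, as the growth hypothesis requires. \<open>E 0\<close>
      belongs to a negative time, but no word uses it.\<close>
    define L where "L = 3 * \<tau>"
    define E where "E m = M (m * L - 2 * \<tau>)" for m :: nat
    \<comment> \<open>The factor \<open>exp (- (2 * \<tau> * h))\<close> pays for the time
      \<open>2 * \<tau>\<close> that the two gaps take from each segment.\<close>
    define K where "K = C * exp (- (2 * \<tau> * h))"
    have "L > 0" "2 * \<tau> \<le> L" "K > 0" using \<tau>(1) C(1) by (auto simp: L_def K_def)
    have E: "E m \<subseteq> A" "flow_separated f (m * L - 2 * \<tau>) (3 * \<epsilon>) (E m)" "finite (E m)" for m
      using M by (auto simp: E_def maximal_flow_separated_def)
    have card_E: "card (E m) \<ge> K * exp (m * (L * h))" if "m \<ge> 1" for m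
    proof -
      have "1 * L \<le> m * L" using that \<open>L > 0\<close> by (intro mult_right_mono) auto
      then have "m * L - 2 * \<tau> > 0" using \<tau>(1) by (simp add: L_def)
      from C(2)[OF this M(1)] have "C * exp ((m * L - 2 * \<tau>) * h) \<le> card (E m)"
        using M(2) by (simp add: E_def real ereal_exp_def ecard_def)
      then show ?thesis by (simp add: K_def algebra_simps flip: exp_add)
    qed
    \<comment> \<open>Each period \<open>L\<close> contributes an extra factor \<open>1 + K\<close>,
      a gain at rate \<open>d / L\<close>; only half of it is claimed, which leaves room for
      constants.\<close>
    define d where "d = ln (1 + K)"
    have "d > 0" using \<open>K > 0\<close> by (simp add: d_def)
    have "ereal (h + d / (2 * L)) \<le> flow_entropy f X"
    proof (rule flow_entropy_geI[OF \<open>\<epsilon> > 0\<close>])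
      fix T :: real
      \<comment> \<open>The half of \<open>d\<close> given up absorbs \<open>ln K\<close> and the
        passage from \<open>N\<close> to \<open>Suc N\<close>; the second estimate makes the time
        exceed \<open>T\<close>.\<close>
      have "\<forall>\<^sub>F N in sequentially. (d / 2) * real (Suc N) \<le> d * real N + ln K"
        using \<open>d > 0\<close> by (intro eventually_affine_le) simp
      moreover have "\<forall>\<^sub>F N in sequentially. 0 * real (Suc N) \<le> L * real N + (- T)"
        using \<open>L > 0\<close> by (intro eventually_affine_le)
      ultimately have "\<forall>\<^sub>F N in sequentially. (d / 2) * real (Suc N) \<le> d * real N + ln K \<and> T \<le> L * real N"
        by eventually_elim simp
      then obtain N where N: "(d / 2) * real (Suc N) \<le> d * real N + ln K" "T \<le> L * real N"
        by (auto simp: eventually_sequentially)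
      obtain g where g: "g ` words E (Suc N) \<subseteq> X"
        "flow_separated f (Suc N * L) \<epsilon> (g ` words E (Suc N))" "inj_on g (words E (Suc N))"
      proof (rule separated_set_of_words)
        show "continuous_flow_on X f" "flow_invariant f A" "A \<subseteq> X" using assms by auto
        show "3 * \<epsilon> < dist a y" if "a \<in> A" for a using that by (rule far)
        show "\<exists>z\<in>X. shadows f \<epsilon> \<tau> z w" if "set w \<subseteq> X \<times> {0..}" for w using that by (rule \<tau>(2))
        show "E m \<subseteq> A" "flow_separated f (m * L - 2 * \<tau>) (3 * \<epsilon>) (E m)" for m by (fact E)+
        show "\<epsilon> > 0" "\<tau> > 0" "2 * \<tau> \<le> L" "y \<in> X" by fact+
      qed (rule that)
      let ?n = "card (words E (Suc N))"
      have ge: "?n \<ge> K * (1 + K) ^ N * exp (Suc N * (L * h))"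
        using E(3) card_E \<open>K > 0\<close> by (intro card_words_ge) auto
      moreover have pos: "K * (1 + K) ^ N * exp (Suc N * (L * h)) > 0"
        using \<open>K > 0\<close> by simp
      ultimately have "?n > 0" by linarith
      have "(h + d / (2 * L)) * (Suc N * L) = (d / 2) * Suc N + Suc N * (L * h)"
        using \<open>L > 0\<close> by (simp add: field_simps)
      also have "\<dots> \<le> (d * N + ln K) + Suc N * (L * h)"
        using N(1) by (rule add_right_mono)
      also have "\<dots> = ln (K * (1 + K) ^ N * exp (Suc N * (L * h)))"
        using \<open>K > 0\<close> by (simp add: ln_mult ln_realpow d_def)
      also have "\<dots> \<le> ln ?n" using ge pos by simp
      finally have "(h + d / (2 * L)) * (Suc N * L) \<le> ln ?n" .
      moreover have "Suc N * L > T" using N(2) \<open>L > 0\<close> by (simp add: algebra_simps)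
      moreover have "card (g ` words E (Suc N)) = ?n" using g(3) by (rule card_image)
      ultimately show "\<exists>t>T. \<exists>S\<subseteq>X. finite S \<and> S \<noteq> {} \<and> flow_separated f t \<epsilon> S \<and>
          (h + d / (2 * L)) * t \<le> ln (card S)"
        using g \<open>?n > 0\<close> by (intro exI[of _ "Suc N * L"] conjI exI[of _ "g ` words E (Suc N)"])
          (auto simp: card_gt_0_iff)
    qed
    moreover have "ereal h < ereal (h + d / (2 * L))" using \<open>d > 0\<close> \<open>L > 0\<close> by simp
    ultimately show ?thesis unfolding real by (rule less_le_trans[rotated])
  qed
qed

end
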